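(* Let $n\ge 1$ and let $\sigma\in\mathfrak S_n$ be a permutation. Let $(\widehat P(\sigma),\widehat Q(\sigma))$ be the pair of standard Young-Fibonacci tableaux obtained by converting into tableaux the two saturated chains read on the right boundary ($\widehat P$) and on the upper boundary ($\widehat Q$) of Fomin's growth diagram of $\sigma$ for the Young-Fibonacci lattice, and let $(P(\sigma),Q(\sigma))$ be the Young-Fibonacci insertion and recording tableaux of $\sigma$. Then $\widehat P(\sigma)=P(\sigma)$ and $\widehat Q(\sigma)=Q(\sigma)$.
   Context: **Snakeshapes.** A snakeshape of size $n$ is a word $u=u_1u_2\cdots u_k$ with letters in $\{1,2\}$ and $u_1+\cdots+u_k=n$; it is drawn as $k$ bottom-justified columns, read from left to right, the $i$-th column having $u_i$ boxes. $\emptyset$ is the empty snakeshape. In a single-boxed column the unique box is both the bottom box and the top box of the column. **Young-Fibonacci lattice.** The snakeshapes are partially ordered by the following covering relations. A snakeshape $u$ is covered exactly by: (1) $1u$ (a single box attached in front); (2) the snakeshape obtained by adding a box on top of the first (leftmost) single-boxed column of $u$, if there is one; (3) if $u$ starts with a (maximal) series of two-boxed columns, every snakeshape obtained by inserting a single-boxed column just after one of the columns of this initial series. **Standard Young-Fibonacci tableaux.** A standard Young-Fibonacci tableau of size $n$ is a numbering of a snakeshape of size $n$ with $1,\dots,n$ (each used once) such that in each two-boxed column the top entry is larger than the bottom entry, and the entry in the top box of any column is larger than all entries in the columns to its right. **Insertion.** $P(\sigma)$ is built column by column from left to right by reading the word $\sigma=\sigma(1)\cdots\sigma(n)$ from right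 to left: each letter $a$ encountered that is not yet matched is compared with the largest not-yet-matched letter $b$ on its left, if any; if $b>a$, then $a$ and $b$ are matched and give the next column, with bottom entry $a$ and top entry $b$; otherwise $a$ gives the next column, single-boxed. $Q(\sigma)$ has the same shape as $P(\sigma)$: if a two-boxed column of $P(\sigma)$ has bottom entry $a$ and top entry $b$, the corresponding column of $Q(\sigma)$ has bottom entry $\sigma^{-1}(b)$ and top entry $\sigma^{-1}(a)$; a single-boxed column with entry $a$ corresponds to a single-boxed column with entry $\sigma^{-1}(a)$. **Growth diagram.** Define snakeshapes $\Lambda(i,j)$, $0\le i,j\le n$, by $\Lambda(i,0)=\Lambda(0,j)=\emptyset$ and, for $i,j\ge1$, with $t=\Lambda(i-1,j-1)$, $x=\Lambda(i-1,j)$, $y=\Lambda(i,j-1)$, $z=\Lambda(i,j)$ and $\alpha=1$ if $\sigma(i)=j$, $\alpha=0$ otherwise, by the local rules: if $x\ne t$ and $y\neq t$ then $z=2t$ ($t$ with a two-boxed column added in front); if $x=y=t$ and $\alpha=1$ then $z=1t$; in all other cases $z=y$ if $x=t$, and $z=x$ if $y=t$. The chain on the upper boundary is $\widehat Q=(\Lambda(0,n),\Lambda(1,n),\dots,\Lambda(n,n))$ and the chain on the right boundary is $\widehat P=(\Lambda(n,0),\Lambda(n,1),\dots,\Lambda(n,n))$; both are saturated chains starting at $\emptyset$ in the Young-Fibonacci lattice. **Converting a saturated chain $(u^0=\emptyset,u^1,\dots,u^n)$ into a tableau.** Start with the empty tableau; given the tableau of shape $u^{m-1}$ with entries $1,\dots,m-1$,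 the tableau of shape $u^m$ is obtained as follows. (i) If the new box lies in the first column of $u^m$ (a new single-boxed column in front, or a box on top of a single-boxed first column), label it $m$. (ii) If the new box lies on top of the $j$-th column with $j\ge2$ (so columns $1,\dots,j-1$ are two-boxed), move the top entry of column $i$ to the top of column $i+1$ for all $1\le i\le j-1$, and put $m$ on top of the first column. (iii) If the new box is a new single-boxed column inserted just after the $j$-th column, $j\ge1$ (columns $1,\dots,j$ being two-boxed), move the top entry of column $j$ into the new box, move the top entry of column $i$ to the top of column $i+1$ for all $1\le i\le j-1$, and put $m$ on top of the first column. $\widehat P(\sigma)$ and $\widehat Q(\sigma)$ are the tableaux obtained in this way from the chains $\widehat P$ and $\widehat Q$. *)

theory Defs
  imports Main "HOL-Combinatorics.Permutations"
begin

type_synonym snakeshape = "nat list"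

definition is_snakeshape :: "snakeshape \<Rightarrow> bool" where
  "is_snakeshape u \<longleftrightarrow> set u \<subseteq> {1, 2}"

definition leading_twos :: "snakeshape \<Rightarrow> nat" where
  "leading_twos u = length (takeWhile (\<lambda>c. c = 2) u)"

text \<open>Lists are indexed from 0, so the first single-boxed column of \<open>u\<close>, if there is one, has
  index \<open>leading_twos u\<close>.\<close>

definition yf_cover :: "snakeshape \<Rightarrow> snakeshape \<Rightarrow> bool" where
  "yf_cover u v \<longleftrightarrow> is_snakeshape u \<and>
     (v = 1 # u
      \<or> (leading_twos u < length u \<and> v = u[leading_twos u := 2])
      \<or> (\<exists>j \<in> {1..leading_twos u}. v = take j u @ 1 # drop j u))"

definition saturated_chain :: "snakeshape list \<Rightarrow> bool" where
  "saturated_chain c \<longleftrightarrow> c \<noteq> [] \<and> hd c = [] \<and>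
     (\<forall>i. Suc i < length c \<longrightarrow> yf_cover (c ! i) (c ! Suc i))"

text \<open>\<open>Double a b\<close> has bottom entry \<open>a\<close> and top entry \<open>b\<close>.\<close>

datatype column = Single nat | Double nat nat

fun bottom_entry :: "column \<Rightarrow> nat" where
  "bottom_entry (Single a) = a"
| "bottom_entry (Double a b) = a"

fun top_entry :: "column \<Rightarrow> nat" where
  "top_entry (Single a) = a"
| "top_entry (Double a b) = b"

fun entries :: "column \<Rightarrow> nat list" where
  "entries (Single a) = [a]"
| "entries (Double a b) = [a, b]"

type_synonym tableau = "column list"

definition standard_tableau :: "nat \<Rightarrow> tableau \<Rightarrow> bool" where
  "standard_tableau n T \<longleftrightarrow>
     distinct (concat (map entries T)) \<and> set (concat (map entries T)) = {1..n} \<and>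
     (\<forall>a b. Double a b \<in> set T \<longrightarrow> a < b) \<and>
     (\<forall>i k. i < k \<longrightarrow> k < length T \<longrightarrow> (\<forall>e \<in> set (entries (T ! k)). e < top_entry (T ! i)))"

text \<open>The argument is the word as it is read, i.e. reversed, and without the letters that have
  already been matched; so after \<open>a\<close> has been read, \<open>w\<close> consists of the not yet matched letters
  to the left of \<open>a\<close>.\<close>

function yf_insert :: "nat list \<Rightarrow> tableau" where
  "yf_insert [] = []"
| "yf_insert (a # w) =
     (if w \<noteq> [] \<and> a < Max (set w)
      then Double a (Max (set w)) # yf_insert (remove1 (Max (set w)) w)
      else Single a # yf_insert w)"
  by pat_completeness auto
termination
  by (relation "measure length") (auto simp: length_remove1)

definition P_tableau :: "nat \<Rightarrow> (nat \<Rightarrow> nat) \<Rightarrow> tableau" where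
  "P_tableau n \<sigma> = yf_insert (rev (map \<sigma> [1..<Suc n]))"

fun record_column :: "(nat \<Rightarrow> nat) \<Rightarrow> column \<Rightarrow> column" where
  "record_column \<sigma> (Single a) = Single (inv \<sigma> a)"
| "record_column \<sigma> (Double a b) = Double (inv \<sigma> b) (inv \<sigma> a)"

definition Q_tableau :: "nat \<Rightarrow> (nat \<Rightarrow> nat) \<Rightarrow> tableau" where
  "Q_tableau n \<sigma> = map (record_column \<sigma>) (P_tableau n \<sigma>)"

definition local_rule ::
    "snakeshape \<Rightarrow> snakeshape \<Rightarrow> snakeshape \<Rightarrow> bool \<Rightarrow> snakeshape" where
  "local_rule t x y \<alpha> =
     (if x \<noteq> t \<and> y \<noteq> t then 2 # t
      else if x = t \<and> y = t \<and> \<alpha> then 1 # t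
      else if x = t then y else x)"

fun growth :: "(nat \<Rightarrow> nat) \<Rightarrow> nat \<Rightarrow> nat \<Rightarrow> snakeshape" where
  "growth \<sigma> 0 j = []"
| "growth \<sigma> (Suc i) 0 = []"
| "growth \<sigma> (Suc i) (Suc j) =
     local_rule (growth \<sigma> i j) (growth \<sigma> i (Suc j)) (growth \<sigma> (Suc i) j) (\<sigma> (Suc i) = Suc j)"

definition P_chain :: "nat \<Rightarrow> (nat \<Rightarrow> nat) \<Rightarrow> snakeshape list" where
  "P_chain n \<sigma> = map (\<lambda>j. growth \<sigma> n j) [0..<Suc n]"

definition Q_chain :: "nat \<Rightarrow> (nat \<Rightarrow> nat) \<Rightarrow> snakeshape list" where
  "Q_chain n \<sigma> = map (\<lambda>i. growth \<sigma> i n) [0..<Suc n]"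

text \<open>Simultaneously, the top entry of column \<open>i\<close> moves to the top of column \<open>i + 1\<close> for
  \<open>1 \<le> i \<le> k - 1\<close> (counting columns from 1) and \<open>m\<close> is put on top of column 1.\<close>

definition shift_tops :: "nat \<Rightarrow> nat \<Rightarrow> tableau \<Rightarrow> tableau" where
  "shift_tops m k T =
     map (\<lambda>i. if i < k
               then Double (bottom_entry (T ! i)) (if i = 0 then m else top_entry (T ! (i - 1)))
               else T ! i)
         [0..<length T]"

text \<open>Here \<open>v\<close> covers \<open>u\<close> and \<open>T\<close> has shape \<open>u\<close>; the three branches follow the three kinds of
  covering relations, which exclude each other. In the second one, the new box is on top of column
  number \<open>Suc (leading_twos u)\<close>; if this is the first column, shifting just puts \<open>m\<close> on top of it.
  In the third one, the new column is the first single-boxed column of \<open>v\<close>, so it has been inserted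
  just after column number \<open>leading_twos v\<close>.\<close>

definition convert_step ::
    "nat \<Rightarrow> snakeshape \<Rightarrow> snakeshape \<Rightarrow> tableau \<Rightarrow> tableau" where
  "convert_step m u v T =
     (if v = 1 # u then Single m # T
      else if v = u[leading_twos u := 2] then shift_tops m (Suc (leading_twos u)) T
      else (let j = leading_twos v
            in take j (shift_tops m j T) @ Single (top_entry (T ! (j - 1))) # drop j T))"

definition tableau_of_chain :: "snakeshape list \<Rightarrow> tableau" where
  "tableau_of_chain c = fold (\<lambda>m. convert_step m (c ! (m - 1)) (c ! m)) [1..<length c] []"

definition P_hat :: "nat \<Rightarrow> (nat \<Rightarrow> nat) \<Rightarrow> tableau" where
  "P_hat n \<sigma> = tableau_of_chain (P_chain n \<sigma>)"

definition Q_hat :: "nat \<Rightarrow> (nat \<Rightarrow> nat) \<Rightarrow> tableau" where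
  "Q_hat n \<sigma> = tableau_of_chain (Q_chain n \<sigma>)"

end

theory Submission
  imports Defs
begin

text \<open>Regard a partial permutation as a finite set of points (position, value), no two of them in a
  common row or column. The insertion repeatedly removes the rightmost and the highest point, which
  form a column (single-boxed if they coincide). This rule is invariant under reflection in the
  diagonal, so the recording tableau of \<open>\<sigma>\<close> is the insertion tableau of its inverse; the growth
  diagram has the same symmetry. The growth diagram computes the shapes of the insertion tableaux
  of the restrictions of \<open>\<sigma>\<close> to lower left rectangles: if the last row and the last column of a
  rectangle contain different points, then these are the highest and the rightmost point, and
  removing them leaves the points of the smaller rectangle. Finally, adding a new highest point to a
  set acts on the insertion tableau by the conversion rule for chains: in the first column it
  replaces the top entry, and the previous highest point then plays the role of the new point in
  the remaining columns.\<close>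

section \<open>Placements and the matching of their extreme points\<close>

type_synonym point = "nat \<times> nat"

definition placement :: "point set \<Rightarrow> bool" where
  "placement S \<longleftrightarrow> finite S \<and> inj_on fst S \<and> inj_on snd S"

text \<open>The maximiser itself is needed, so it is chosen; on a nonempty placement it is unique
  for \<open>fst\<close> and for \<open>snd\<close>, by injectivity.\<close>

definition highest :: "(point \<Rightarrow> nat) \<Rightarrow> point set \<Rightarrow> point" where
  "highest f S = (SOME p. p \<in> S \<and> (\<forall>r\<in>S. f r \<le> f p))"

lemma ex_highest:
  fixes f :: "point \<Rightarrow> nat"
  assumes "finite S" "S \<noteq> {}"
  shows "\<exists>p. p \<in> S \<and> (\<forall>r\<in>S. f r \<le> f p)"
proof -
  have "Max (f ` S) \<in> f ` S" using assms by (intro Max_in) auto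
  then obtain p where "p \<in> S" "f p = Max (f ` S)" by auto
  then show ?thesis using assms by (metis Max_ge finite_imageI imageI)
qed

lemma highest_in: "finite S \<Longrightarrow> S \<noteq> {} \<Longrightarrow> highest f S \<in> S"
  and highest_ge: "finite S \<Longrightarrow> r \<in> S \<Longrightarrow> f r \<le> f (highest f S)"
  unfolding highest_def using someI_ex[OF ex_highest, of S f] by blast+

lemma highest_eqI:
  assumes "finite S" "inj_on f S" "p \<in> S" "\<forall>r\<in>S. f r \<le> f p"
  shows "highest f S = p"
proof -
  have "highest f S \<in> S" "f p \<le> f (highest f S)"
    using assms highest_in[of S f] highest_ge[of S p f] by blast+
  then show ?thesis using assms by (metis inj_onD le_antisym)
qed

lemma less_highest:
  fixes f :: "point \<Rightarrow> nat"
  assumes "inj_on f S" "q \<in> S" "\<forall>r\<in>S. f r \<le> f q" "r \<in> S" "r \<noteq> q"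
  shows "f r < f q"
proof -
  have "f r \<noteq> f q" "f r \<le> f q" using assms by (auto dest: inj_onD)
  then show ?thesis by simp
qed

text \<open>Pairs of points are kept, not only their heights, so that reflection in the diagonal can
  act on the result. The finiteness test makes the recursion total: infinite sets get the default
  value \<open>[]\<close>.\<close>

function matching :: "point set \<Rightarrow> (point \<times> point) list" where
  "matching S =
     (if finite S \<and> S \<noteq> {}
      then (highest fst S, highest snd S) # matching (S - {highest fst S, highest snd S})
      else [])"
  by pat_completeness auto
termination
proof (relation "measure card")
  fix S :: "point set"
  assume "finite S \<and> S \<noteq> {}"
  then have "card (S - {highest fst S, highest snd S}) < card S"
    using highest_in[of S fst] by (intro psubset_card_mono) auto
  then show "(S - {highest fst S, highest snd S}, S) \<in> measure card" by simp
qed simp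

declare matching.simps [simp del]

lemma matching_empty [simp]: "matching {} = []"
  by (simp add: matching.simps)

lemma matching_eq:
  assumes "placement S" "p \<in> S" "q \<in> S" "\<forall>r\<in>S. fst r \<le> fst p" "\<forall>r\<in>S. snd r \<le> snd q"
  shows "matching S = (p, q) # matching (S - {p, q})"
proof -
  have "highest fst S = p" "highest snd S = q"
    using assms by (auto simp: placement_def intro: highest_eqI)
  then show ?thesis using assms by (subst matching.simps) (auto simp: placement_def)
qed

lemma placement_subset: "placement S \<Longrightarrow> R \<subseteq> S \<Longrightarrow> placement R"
  by (auto simp: placement_def intro: finite_subset inj_on_subset)

text \<open>Induction along the recursion of \<open>matching\<close>, for any rightmost
  \<open>p\<close> and highest \<open>q\<close>, which may coincide. Together with
  \<open>matching_eq\<close> it keeps the choice in \<open>highest\<close> out of the later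
  proofs.\<close>

lemma placement_induct [consumes 1, case_names empty step]:
  assumes "placement S"
    and "P {}"
    and step: "\<And>S p q. placement S \<Longrightarrow> p \<in> S \<Longrightarrow> q \<in> S \<Longrightarrow> \<forall>r\<in>S. fst r \<le> fst p \<Longrightarrow>
      \<forall>r\<in>S. snd r \<le> snd q \<Longrightarrow> P (S - {p, q}) \<Longrightarrow> P S"
  shows "P S"
  using assms(1)
proof (induction "card S" arbitrary: S rule: less_induct)
  case less
  show ?case
  proof (cases "S = {}")
    case False
    have fin: "finite S" using less.prems by (simp add: placement_def)
    obtain p q where pq: "p \<in> S" "\<forall>r\<in>S. fst r \<le> fst p" "q \<in> S" "\<forall>r\<in>S. snd r \<le> snd q"
      using ex_highest[OF fin False, of fst] ex_highest[OF fin False, of snd] by blast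
    have "card (S - {p, q}) < card S"
      using fin pq by (intro psubset_card_mono) auto
    then have "P (S - {p, q})"
      using less placement_subset[of S "S - {p, q}"] by blast
    then show ?thesis using step less.prems pq by blast
  qed (use assms(2) in simp)
qed

section \<open>Tableaux of placements: shapes and standardness\<close>

fun column_of :: "point \<times> point \<Rightarrow> column" where
  "column_of (p, q) = (if p = q then Single (snd p) else Double (snd p) (snd q))"

definition tableau_of :: "point set \<Rightarrow> tableau" where
  "tableau_of S = map column_of (matching S)"

definition shape :: "tableau \<Rightarrow> snakeshape" where
  "shape T = map (length \<circ> entries) T"

lemma tableau_of_empty [simp]: "tableau_of {} = []"
  by (simp add: tableau_of_def)

lemma tableau_of_eq:
  assumes "placement S" "p \<in> S" "q \<in> S" "\<forall>r\<in>S. fst r \<le> fst p" "\<forall>r\<in>S. snd r \<le> snd q"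
  shows "tableau_of S = column_of (p, q) # tableau_of (S - {p, q})"
  by (simp add: tableau_of_def matching_eq[OF assms])

lemma shape_simps [simp]:
  "shape [] = []" "shape (Single a # T) = 1 # shape T" "shape (Double a b # T) = 2 # shape T"
  "length (shape T) = length T"
  by (simp_all add: shape_def)

lemma is_snakeshape_shape: "is_snakeshape (shape T)"
proof -
  have "length (entries c) \<in> {1, 2}" for c by (cases c) auto
  then show ?thesis by (auto simp: is_snakeshape_def shape_def)
qed

text \<open>Each column uses up as many points as it has boxes. This allows shapes to be told apart
  by counting points.\<close>

lemma sum_list_shape_tableau_of: "placement S \<Longrightarrow> sum_list (shape (tableau_of S)) = card S"
proof (induction S rule: placement_induct)
  case (step S p q)
  have fin: "finite S" using step by (simp add: placement_def)
  have "card (S - {p, q}) + card {p, q} = card S"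
    using step fin by (metis card_Diff_subset card_mono finite.emptyI finite.insertI
        empty_subsetI insert_subset le_add_diff_inverse2)
  then show ?case
    using step.IH by (cases "p = q") (simp_all add: tableau_of_eq[OF step.hyps(1-5)])
qed simp

lemma entries_tableau_of:
  "placement S \<Longrightarrow> distinct (concat (map entries (tableau_of S))) \<and>
    set (concat (map entries (tableau_of S))) = snd ` S"
proof (induction S rule: placement_induct)
  case (step S p q)
  have inj: "inj_on snd S" using step by (simp add: placement_def)
  have "p = q \<or> snd p \<noteq> snd q" "snd p \<notin> snd ` (S - {p, q})" "snd q \<notin> snd ` (S - {p, q})"
    using inj step.hyps by (auto dest: inj_onD)
  moreover have "snd ` S = insert (snd p) (insert (snd q) (snd ` (S - {p, q})))"
    using step.hyps by auto
  ultimately show ?case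
    using step.IH by (auto simp: tableau_of_eq[OF step.hyps(1-5)])
qed simp

text \<open>The top entry of the first column is the height of the highest point \<open>q\<close>,
  which exceeds all other heights; by \<open>entries_tableau_of\<close> the remaining columns
  contain only such other heights.\<close>

lemma tableau_of_decreasing:
  "placement S \<Longrightarrow> (\<forall>a b. Double a b \<in> set (tableau_of S) \<longrightarrow> a < b) \<and>
    sorted_wrt (\<lambda>c d. \<forall>e\<in>set (entries d). e < top_entry c) (tableau_of S)"
proof (induction S rule: placement_induct)
  case (step S p q)
  have inj: "inj_on snd S" using step by (simp add: placement_def)
  have "placement (S - {p, q})" using step.hyps(1) by (rule placement_subset) auto
  then have ent: "set (concat (map entries (tableau_of (S - {p, q})))) = snd ` (S - {p, q})"
    using entries_tableau_of by blast
  note less = less_highest[OF inj step.hyps(3,5)]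
  have below: "\<forall>d\<in>set (tableau_of (S - {p, q})). \<forall>e\<in>set (entries d). e < snd q"
  proof (intro ballI)
    fix d e
    assume "d \<in> set (tableau_of (S - {p, q}))" "e \<in> set (entries d)"
    then have "e \<in> snd ` (S - {p, q})" unfolding ent[symmetric] by auto
    then show "e < snd q" using less by auto
  qed
  have "p \<noteq> q \<Longrightarrow> snd p < snd q" using less step.hyps(2) by simp
  moreover have "top_entry (column_of (p, q)) = snd q" by simp
  ultimately show ?case
    using step.IH below by (auto simp: tableau_of_eq[OF step.hyps(1-5)])
qed simp

lemma standard_tableau_of:
  assumes "placement S" "snd ` S = {1..n}"
  shows "standard_tableau n (tableau_of S)"
  using entries_tableau_of[OF assms(1)] tableau_of_decreasing[OF assms(1)] assms(2)
  unfolding standard_tableau_def sorted_wrt_iff_nth_less by auto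

section \<open>Insertion of a word as the tableau of a placement\<close>

lemma remove1_map:
  "inj_on f (insert x (set xs)) \<Longrightarrow> remove1 (f x) (map f xs) = map f (remove1 x xs)"
proof (induction xs)
  case (Cons y xs)
  from Cons.prems have "inj_on f (insert x (set xs))" by (rule inj_on_subset) auto
  note IH = Cons.IH[OF this]
  have "f x = f y \<longleftrightarrow> x = y" using Cons.prems by (auto dest: inj_onD)
  then show ?case by (auto simp: IH)
qed simp

lemma sorted_wrt_imp_distinct:
  "sorted_wrt P xs \<Longrightarrow> (\<And>x. \<not> P x x) \<Longrightarrow> distinct xs"
  by (induction xs) auto

lemma sorted_wrt_imp_inj_on:
  fixes f :: "'a \<Rightarrow> 'b::linorder"
  shows "sorted_wrt (\<lambda>x y. f y < f x) xs \<Longrightarrow> inj_on f (set xs)"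
  by (induction xs) fastforce+

text \<open>With positions decreasing, the head of the list is the rightmost point. Either it is
  also the highest, and its letter stays single, or the highest point lies in the tail and carries
  the maximal letter there. Removing both points leaves a list of the same kind.\<close>

lemma yf_insert_eq_tableau_of:
  assumes "inj_on snd (set xs)" "sorted_wrt (\<lambda>p q. fst q < fst p) xs"
  shows "yf_insert (map snd xs) = tableau_of (set xs)"
  using assms
proof (induction "length xs" arbitrary: xs rule: less_induct)
  case less
  show ?case
  proof (cases xs)
    case (Cons p ys)
    have dist: "distinct xs"
      using less.prems(2) by (rule sorted_wrt_imp_distinct) simp
    have "inj_on fst (set xs)"
      using less.prems(2) by (rule sorted_wrt_imp_inj_on)
    then have pl: "placement (set xs)"
      using less.prems(1) by (simp add: placement_def)
    have p: "p \<in> set xs" "\<forall>r\<in>set xs. fst r \<le> fst p"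
      using less.prems(2) Cons by auto
    have "set xs \<noteq> {}" using Cons by simp
    from ex_highest[OF finite_set this, of snd]
    obtain q where q: "q \<in> set xs" "\<forall>r\<in>set xs. snd r \<le> snd q" by blast
    note eq = tableau_of_eq[OF pl p(1) q(1) p(2) q(2)]
    show ?thesis
    proof (cases "p = q")
      case True
      have "\<not> (map snd ys \<noteq> [] \<and> snd p < Max (set (map snd ys)))"
        using q Cons True by (auto simp: Max_gr_iff leD)
      moreover have "yf_insert (map snd ys) = tableau_of (set ys)"
        using less.prems Cons by (intro less.hyps) auto
      moreover have "set xs - {p, q} = set ys" using dist Cons True by auto
      ultimately show ?thesis using eq Cons True by simp
    next
      case False
      then have qy: "q \<in> set ys" using q Cons by simp
      have max: "Max (set (map snd ys)) = snd q"
        using q qy Cons by (intro Max_eqI) auto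
      have lt: "snd p < snd q"
        using less_highest[OF less.prems(1) q p(1) False] .
      have rem: "remove1 (snd q) (map snd ys) = map snd (remove1 q ys)"
        using qy Cons by (intro remove1_map inj_on_subset[OF less.prems(1)]) auto
      have IH: "yf_insert (map snd (remove1 q ys)) = tableau_of (set (remove1 q ys))"
      proof (rule less.hyps)
        show "length (remove1 q ys) < length xs"
          using Cons by (simp add: length_remove1 le_imp_less_Suc)
        have "set (remove1 q ys) \<subseteq> set xs" using set_remove1_subset[of q ys] Cons by auto
        then show "inj_on snd (set (remove1 q ys))" using less.prems(1) by (rule inj_on_subset[rotated])
        show "sorted_wrt (\<lambda>p q. fst q < fst p) (remove1 q ys)"
          using less.prems(2) dist Cons
          by (simp add: distinct_remove1_removeAll removeAll_filter_not_eq sorted_wrt_filter)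
      qed
      have "yf_insert (map snd xs) = Double (snd p) (snd q) # yf_insert (remove1 (snd q) (map snd ys))"
        using max lt qy by (auto simp: Cons)
      also have "\<dots> = Double (snd p) (snd q) # tableau_of (set (remove1 q ys))"
        by (simp only: rem IH)
      also have "set (remove1 q ys) = set xs - {p, q}" using dist Cons by auto
      also have "Double (snd p) (snd q) # tableau_of (set xs - {p, q}) = tableau_of (set xs)"
        using eq False by simp
      finally show ?thesis .
    qed
  qed simp
qed

section \<open>Covers and the conversion rule, one column at a time\<close>

lemma leading_twos_simps [simp]:
  "leading_twos [] = 0" "leading_twos (Suc 0 # u) = 0" "leading_twos (2 # u) = Suc (leading_twos u)"
  by (simp_all add: leading_twos_def)

text \<open>Shows that the third branch of \<open>convert_step\<close> recovers the place of
  insertion from the larger shape alone.\<close>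

lemma leading_twos_insert:
  "j \<le> leading_twos u \<Longrightarrow> leading_twos (take j u @ 1 # drop j u) = j"
proof (induction u arbitrary: j)
  case (Cons c u)
  then show ?case by (cases j) (auto simp: leading_twos_def split: if_splits)
qed simp

text \<open>A column attached in front of \<open>u\<close> becomes one inserted after the first
  column of \<open>2 # u\<close>; a box on top stays a box on top; an insertion after column
  \<open>j\<close> becomes one after column \<open>Suc j\<close>.\<close>

lemma yf_cover_Cons_2:
  assumes "yf_cover u v"
  shows "yf_cover (2 # u) (2 # v)"
proof -
  consider "v = 1 # u" | "leading_twos u < length u" "v = u[leading_twos u := 2]"
    | j where "j \<in> {1..leading_twos u}" "v = take j u @ 1 # drop j u"
    using assms unfolding yf_cover_def by blast
  then have "(leading_twos (2 # u) < length (2 # u) \<and> 2 # v = (2 # u)[leading_twos (2 # u) := 2])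
    \<or> (\<exists>j \<in> {1..leading_twos (2 # u)}. 2 # v = take j (2 # u) @ 1 # drop j (2 # u))"
  proof cases
    case 1
    then show ?thesis by (intro disjI2 bexI[of _ 1]) auto
  next
    case 2
    then show ?thesis by simp
  next
    case (3 j)
    then show ?thesis by (intro disjI2 bexI[of _ "Suc j"]) auto
  qed
  then show ?thesis using assms by (auto simp: yf_cover_def is_snakeshape_def)
qed

lemma shift_tops_0 [simp]: "shift_tops m 0 T = T"
  by (simp add: shift_tops_def map_nth)

lemma length_shift_tops [simp]: "length (shift_tops m k T) = length T"
  by (simp add: shift_tops_def)

text \<open>Turns the simultaneous shift into a recursion: the displaced top entry acts as the new
  label for the remaining columns.\<close>

lemma shift_tops_Suc [simp]:
  "shift_tops m (Suc k) (c # T) = Double (bottom_entry c) m # shift_tops (top_entry c) k T"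
proof (rule nth_equalityI)
  fix i
  assume "i < length (shift_tops m (Suc k) (c # T))"
  then show "shift_tops m (Suc k) (c # T) ! i =
      (Double (bottom_entry c) m # shift_tops (top_entry c) k T) ! i"
    by (cases i) (auto simp: shift_tops_def nth_Cons' simp del: upt_Suc)
qed simp

text \<open>The label \<open>m\<close> displaces \<open>b\<close>, which then acts as the new label
  behind the first column. The work lies in checking which branch each side takes: a box on top
  preserves the number of columns, the other covers increase it.\<close>

lemma convert_step_Cons_2:
  assumes "yf_cover u v"
  shows "convert_step m (2 # u) (2 # v) (Double a b # T) = Double a m # convert_step b u v T"
proof -
  consider "v = 1 # u" | "leading_twos u < length u" "v = u[leading_twos u := 2]"
    | j where "j \<in> {1..leading_twos u}" "v = take j u @ 1 # drop j u"
    using assms unfolding yf_cover_def by blast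
  then show ?thesis
  proof cases
    case 1
    then have "2 # v \<noteq> (2 # u)[leading_twos (2 # u) := 2]"
      by (metis length_Cons length_list_update n_not_Suc_n)
    then show ?thesis using 1 by (simp add: convert_step_def)
  next
    case 2
    then have "v \<noteq> 1 # u" by (metis length_Cons length_list_update n_not_Suc_n)
    then show ?thesis using 2 by (simp add: convert_step_def)
  next
    case (3 j)
    have len: "length v = Suc (length u)" using 3 by simp
    then have "v \<noteq> u[leading_twos u := 2]" by (metis length_list_update n_not_Suc_n)
    \<comment> \<open>As \<open>j\<close> is at least 1, \<open>u\<close> begins with a 2 and
      \<open>v\<close> keeps it in front.\<close>
    moreover have "v \<noteq> 1 # u"
      using 3 by (cases u; cases j) (auto simp: leading_twos_def split: if_splits)
    moreover have "leading_twos v = j" using 3 leading_twos_insert by simp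
    ultimately show ?thesis
      using 3 by (cases j) (auto simp: convert_step_def Let_def)
  qed
qed

text \<open>If \<open>z\<close> is also rightmost, it forms a new single column in front. Otherwise
  it is paired with the old rightmost point \<open>p\<close>: it is put on top of \<open>p\<close>
  if \<open>p\<close> was single, and else it replaces the partner \<open>q\<close> of
  \<open>p\<close>, which is passed on to the other columns.\<close>

lemma insert_top_point:
  assumes "placement S" "placement (insert z S)" "\<forall>r\<in>S. snd r < snd z"
  shows "yf_cover (shape (tableau_of S)) (shape (tableau_of (insert z S))) \<and>
    convert_step (snd z) (shape (tableau_of S)) (shape (tableau_of (insert z S))) (tableau_of S) =
      tableau_of (insert z S)"
  using assms
proof (induction S arbitrary: z rule: placement_induct)
  case empty
  have "tableau_of {z} = column_of (z, z) # tableau_of ({z} - {z, z})"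
    using empty by (intro tableau_of_eq) auto
  then show ?case by (simp add: yf_cover_def is_snakeshape_def convert_step_def)
next
  case (step S p q)
  note S = tableau_of_eq[OF step.hyps(1-5)]
  have z: "z \<notin> S" "\<forall>r\<in>insert z S. snd r \<le> snd z" using step.prems by (auto intro: less_imp_le)
  have snake: "is_snakeshape (shape T)" for T by (rule is_snakeshape_shape)
  show ?case
  proof (cases "fst p < fst z")
    case True
    then have "\<forall>r\<in>insert z S. fst r \<le> fst z" using step.hyps by fastforce
    then have "tableau_of (insert z S) = column_of (z, z) # tableau_of (insert z S - {z, z})"
      using step.prems z by (intro tableau_of_eq) auto
    then show ?thesis using z snake by (simp add: yf_cover_def convert_step_def)
  next
    case False
    then have "\<forall>r\<in>insert z S. fst r \<le> fst p" using step.hyps by auto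
    then have "tableau_of (insert z S) = column_of (p, z) # tableau_of (insert z S - {p, z})"
      using step z by (intro tableau_of_eq) auto
    moreover have "p \<noteq> z" "insert z S - {p, z} = S - {p}" using z step.hyps by auto
    ultimately have iz: "tableau_of (insert z S) = Double (snd p) (snd z) # tableau_of (S - {p})"
      by simp
    show ?thesis
    proof (cases "p = q")
      case True
      have "is_snakeshape (1 # shape (tableau_of (S - {p})))"
        using snake by (simp add: is_snakeshape_def)
      then show ?thesis
        using True by (simp add: S iz yf_cover_def convert_step_def)
    next
      case False
      \<comment> \<open>The released point \<open>q\<close> is above all of
        \<open>S - {p, q}\<close>, so the induction hypothesis applies with \<open>q\<close> as the
        new point.\<close>
      have ins: "insert q (S - {p, q}) = S - {p}" using False step.hyps by auto
      have "\<forall>r\<in>S - {p, q}. snd r < snd q"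
        using less_highest[OF _ step.hyps(3,5)] step.hyps(1) by (simp add: placement_def)
      moreover have "placement (insert q (S - {p, q}))"
        using step.hyps(1) ins by (auto intro: placement_subset)
      ultimately have "yf_cover (shape (tableau_of (S - {p, q}))) (shape (tableau_of (S - {p})))"
        "convert_step (snd q) (shape (tableau_of (S - {p, q}))) (shape (tableau_of (S - {p})))
          (tableau_of (S - {p, q})) = tableau_of (S - {p})"
        using step.IH[of q] by (simp_all add: ins)
      then show ?thesis
        using False by (simp add: S iz yf_cover_Cons_2 convert_step_Cons_2)
    qed
  qed
qed

section \<open>Shapes in the growth diagram\<close>

definition box :: "(nat \<Rightarrow> nat) \<Rightarrow> nat \<Rightarrow> nat \<Rightarrow> point set" where
  "box \<sigma> i j = {(k, \<sigma> k) |k. k \<in> {1..i} \<and> \<sigma> k \<in> {1..j}}"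

lemma placement_box: "inj \<sigma> \<Longrightarrow> placement (box \<sigma> i j)"
proof -
  assume "inj \<sigma>"
  moreover have "finite (box \<sigma> i j)"
    by (rule finite_subset[of _ "(\<lambda>k. (k, \<sigma> k)) ` {1..i}"]) (auto simp: box_def)
  ultimately show ?thesis by (auto simp: placement_def box_def inj_on_def)
qed

lemma box_insert:
  assumes "inj \<sigma>" "q \<in> {1..i}" "\<sigma> q = Suc j"
  shows "box \<sigma> i (Suc j) = insert (q, Suc j) (box \<sigma> i j)"
proof -
  have "\<sigma> k \<in> {1..Suc j} \<longleftrightarrow> \<sigma> k \<in> {1..j} \<or> k = q" for k
    using assms(3) injD[OF assms(1), of k q] by (auto simp: le_Suc_eq)
  then show ?thesis using assms by (auto simp: box_def)
qed

text \<open>Enlarging the rectangle adds at most one point at position \<open>Suc i\<close> and at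
  most one at height \<open>Suc j\<close>; which of them exist, and whether they coincide, selects
  the branch of the local rule.\<close>

lemma growth_eq_shape:
  assumes "inj \<sigma>"
  shows "growth \<sigma> i j = shape (tableau_of (box \<sigma> i j))"
  using assms
proof (induction \<sigma> i j rule: growth.induct)
  case (3 \<sigma> i j)
  let ?f = "\<lambda>i j. shape (tableau_of (box \<sigma> i j))"
  note inj = \<open>inj \<sigma>\<close>
  note pl = placement_box[OF inj]
  have card: "sum_list (?f i j) = card (box \<sigma> i j)" for i j
    using sum_list_shape_tableau_of pl by blast
  have fin: "finite (box \<sigma> i j)" for i j using pl by (simp add: placement_def)
  have row: "box \<sigma> (Suc i) k = (if \<sigma> (Suc i) \<in> {1..k} then insert (Suc i, \<sigma> (Suc i)) (box \<sigma> i k)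
      else box \<sigma> i k)" for k
    by (auto simp: box_def le_Suc_eq)
  have bound: "\<forall>r\<in>box \<sigma> (Suc i) (Suc j). fst r \<le> Suc i"
    "\<forall>r\<in>box \<sigma> (Suc i) (Suc j). snd r \<le> Suc j"
    by (auto simp: box_def)
  have nrow: "(Suc i, b) \<notin> box \<sigma> i k" for b k by (auto simp: box_def)
  have ncol: "(b, Suc j) \<notin> box \<sigma> k j" for b k by (auto simp: box_def)
  have no_col: "box \<sigma> k (Suc j) = box \<sigma> k j" if "\<And>q. q \<in> {1..k} \<Longrightarrow> \<sigma> q \<noteq> Suc j" for k
    using that by (auto simp: box_def le_Suc_eq)
  have "?f (Suc i) (Suc j) =
      local_rule (?f i j) (?f i (Suc j)) (?f (Suc i) j) (\<sigma> (Suc i) = Suc j)"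
  proof -
    consider (corner) "\<sigma> (Suc i) = Suc j" | (empty_row) "\<sigma> (Suc i) \<notin> {1..Suc j}"
      | (empty_col) "\<And>q. q \<in> {1..Suc i} \<Longrightarrow> \<sigma> q \<noteq> Suc j"
      | (both) q where "\<sigma> (Suc i) \<in> {1..j}" "q \<in> {1..i}" "\<sigma> q = Suc j"
      by (metis atLeastAtMost_iff le_Suc_eq)
    then show ?thesis
    proof cases
      case corner
      let ?z = "(Suc i, Suc j)"
      have "\<And>q. q \<in> {1..i} \<Longrightarrow> \<sigma> q \<noteq> Suc j"
        using corner injD[OF inj, of _ "Suc i"] by fastforce
      then have x: "box \<sigma> i (Suc j) = box \<sigma> i j" by (rule no_col)
      have y: "box \<sigma> (Suc i) j = box \<sigma> i j" using row[of j] corner by simp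
      have z: "box \<sigma> (Suc i) (Suc j) = insert ?z (box \<sigma> i j)" using row[of "Suc j"] corner x by simp
      have "tableau_of (box \<sigma> (Suc i) (Suc j)) =
          column_of (?z, ?z) # tableau_of (box \<sigma> (Suc i) (Suc j) - {?z, ?z})"
        by (rule tableau_of_eq[OF pl]) (use bound in \<open>simp_all add: z\<close>)
      moreover have "box \<sigma> (Suc i) (Suc j) - {?z, ?z} = box \<sigma> i j" using z nrow by auto
      ultimately show ?thesis using corner x y by (simp add: local_rule_def)
    next
      case empty_row
      then have "box \<sigma> (Suc i) (Suc j) = box \<sigma> i (Suc j)" "box \<sigma> (Suc i) j = box \<sigma> i j"
        using row by auto
      \<comment> \<open>If the left neighbour has the shape of the diagonal one as well, the rule
        returns the lower neighbour, which then has the same shape.\<close>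
      then show ?thesis using empty_row by (auto simp: local_rule_def)
    next
      case empty_col
      then have "box \<sigma> (Suc i) (Suc j) = box \<sigma> (Suc i) j" "box \<sigma> i (Suc j) = box \<sigma> i j"
        by (intro no_col; simp)+
      then show ?thesis using empty_col[of "Suc i"] by (auto simp: local_rule_def)
    next
      case both
      let ?p = "(Suc i, \<sigma> (Suc i))" and ?q = "(q, Suc j)"
      have x: "box \<sigma> i (Suc j) = insert ?q (box \<sigma> i j)" using box_insert[OF inj] both by simp
      have y: "box \<sigma> (Suc i) j = insert ?p (box \<sigma> i j)" using row both by simp
      have z: "box \<sigma> (Suc i) (Suc j) = insert ?p (insert ?q (box \<sigma> i j))"
        using row[of "Suc j"] both x by simp
      \<comment> \<open>One extra point means one extra box, so both neighbouring shapes differ from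
        the diagonal one and the first branch of the rule applies.\<close>
      have "card (box \<sigma> i (Suc j)) \<noteq> card (box \<sigma> i j)"
        "card (box \<sigma> (Suc i) j) \<noteq> card (box \<sigma> i j)"
        unfolding x y by (simp_all add: fin nrow ncol)
      then have "?f i (Suc j) \<noteq> ?f i j" "?f (Suc i) j \<noteq> ?f i j" by (metis card)+
      moreover have "tableau_of (box \<sigma> (Suc i) (Suc j)) =
          column_of (?p, ?q) # tableau_of (box \<sigma> (Suc i) (Suc j) - {?p, ?q})"
        by (rule tableau_of_eq[OF pl]) (use bound in \<open>simp_all add: z\<close>)
      moreover have "box \<sigma> (Suc i) (Suc j) - {?p, ?q} = box \<sigma> i j" using z nrow ncol by auto
      ultimately show ?thesis using both(2) by (simp add: local_rule_def)
    qed
  qed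
  then show ?case using 3 by simp
qed (simp_all add: box_def)

text \<open>The local rule is symmetric in \<open>x\<close> and \<open>y\<close>, and inversion
  transposes the marked cells.\<close>

lemma growth_inv:
  assumes "bij \<sigma>"
  shows "growth \<sigma> i j = growth (inv \<sigma>) j i"
  using assms
proof (induction \<sigma> i j rule: growth.induct)
  case (1 \<sigma> j)
  then show ?case by (cases j) auto
next
  case (3 \<sigma> i j)
  have "inv \<sigma> (Suc j) = Suc i \<longleftrightarrow> \<sigma> (Suc i) = Suc j"
    using bij_inv_eq_iff[OF \<open>bij \<sigma>\<close>] by metis
  then show ?case using 3 by (auto simp: local_rule_def)
qed simp

section \<open>The right boundary for a permutation\<close>

context
  fixes n :: nat and \<sigma> :: "nat \<Rightarrow> nat"
  assumes perm: "\<sigma> permutes {1..n}"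
begin

lemma box_full: "box \<sigma> n n = (\<lambda>k. (k, \<sigma> k)) ` {1..n}"
  using permutes_in_image[OF perm] by (auto simp: box_def simp del: atLeastAtMost_iff)

lemma P_tableau_eq: "P_tableau n \<sigma> = tableau_of (box \<sigma> n n)"
proof -
  let ?xs = "rev (map (\<lambda>k. (k, \<sigma> k)) [1..<Suc n])"
  have set: "set ?xs = box \<sigma> n n" unfolding box_full by auto
  have "inj_on snd (set ?xs)"
    using placement_box[OF permutes_inj[OF perm]] unfolding set placement_def by blast
  moreover have "sorted_wrt (\<lambda>p q. fst q < fst p) ?xs"
    unfolding sorted_wrt_rev sorted_wrt_map fst_conv by (rule sorted_wrt_upt)
  moreover have "map snd ?xs = rev (map \<sigma> [1..<Suc n])" by (simp add: rev_map comp_def)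
  ultimately show ?thesis
    unfolding P_tableau_def using yf_insert_eq_tableau_of[of ?xs] set by metis
qed

lemma standard_P: "standard_tableau n (P_tableau n \<sigma>)"
  unfolding P_tableau_eq
proof (rule standard_tableau_of)
  show "snd ` box \<sigma> n n = {1..n}"
    unfolding box_full using permutes_image[OF perm] by (simp add: image_image)
qed (rule placement_box[OF permutes_inj[OF perm]])

text \<open>Surjectivity supplies a point at height \<open>Suc j\<close>. It lies above all of
  \<open>box \<sigma> n j\<close>, so \<open>insert_top_point\<close> applies with exactly the label
  used by the conversion.\<close>

lemma chain_step:
  assumes "j < n"
  shows "yf_cover (growth \<sigma> n j) (growth \<sigma> n (Suc j)) \<and>
    convert_step (Suc j) (growth \<sigma> n j) (growth \<sigma> n (Suc j)) (tableau_of (box \<sigma> n j)) =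
      tableau_of (box \<sigma> n (Suc j))"
proof -
  have inj: "inj \<sigma>" using perm by (rule permutes_inj)
  have "Suc j \<in> \<sigma> ` {1..n}" using permutes_image[OF perm] assms by simp
  then obtain k where k: "k \<in> {1..n}" "\<sigma> k = Suc j" by force
  have "box \<sigma> n (Suc j) = insert (k, Suc j) (box \<sigma> n j)"
    using box_insert[OF inj k] .
  moreover have "\<forall>r\<in>box \<sigma> n j. snd r < snd (k, Suc j)" by (auto simp: box_def)
  ultimately show ?thesis
    using insert_top_point[of "box \<sigma> n j" "(k, Suc j)"] placement_box[OF inj]
    by (metis growth_eq_shape[OF inj] snd_conv)
qed

lemma saturated_P_chain: "saturated_chain (P_chain n \<sigma>)"
proof -
  have "growth \<sigma> n 0 = []" by (cases n) auto
  then show ?thesis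
    using chain_step
    by (auto simp: saturated_chain_def P_chain_def hd_map hd_append simp del: upt_Suc)
qed

lemma P_hat_eq: "P_hat n \<sigma> = P_tableau n \<sigma>"
proof -
  let ?c = "P_chain n \<sigma>"
  have nth: "?c ! j = growth \<sigma> n j" if "j \<le> n" for j
    using that by (simp add: P_chain_def del: upt_Suc)
  \<comment> \<open>Invariant of the conversion; at \<open>j = n\<close> it is the claim.\<close>
  have "fold (\<lambda>m. convert_step m (?c ! (m - 1)) (?c ! m)) [1..<Suc j] [] = tableau_of (box \<sigma> n j)"
    if "j \<le> n" for j
    using that
  proof (induction j)
    case 0
    then show ?case by (simp add: box_def)
  next
    case (Suc j)
    then show ?case using chain_step[of j] by (simp add: nth)
  qed
  from this[of n] show ?thesis
    by (simp add: P_hat_def tableau_of_chain_def P_tableau_eq P_chain_def del: upt_Suc)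
qed

end

section \<open>Reflection and the recording tableau\<close>

text \<open>Reflection exchanges rightmost and highest, so the two members of each pair change
  places as well.\<close>

lemma matching_swap:
  "placement S \<Longrightarrow> matching (prod.swap ` S) = map (\<lambda>(p, q). (prod.swap q, prod.swap p)) (matching S)"
proof (induction S rule: placement_induct)
  case (step S p q)
  have "placement (prod.swap ` S)"
    using step.hyps(1) by (auto simp: placement_def inj_on_def)
  then have "matching (prod.swap ` S) =
      (prod.swap q, prod.swap p) # matching (prod.swap ` S - {prod.swap q, prod.swap p})"
    using step.hyps by (intro matching_eq) auto
  moreover have "prod.swap ` S - {prod.swap q, prod.swap p} = prod.swap ` (S - {p, q})"
    by (simp add: image_set_diff[OF inj_swap] insert_commute)
  ultimately show ?case using step.IH by (simp add: matching_eq[OF step.hyps(1-5)])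
qed simp

text \<open>Guarantees that matched points have the form \<open>(k, \<sigma> k)\<close>, so that
  \<open>inv \<sigma>\<close> turns their heights into positions.\<close>

lemma set_matching: "placement S \<Longrightarrow> set (matching S) \<subseteq> S \<times> S"
proof (induction S rule: placement_induct)
  case (step S p q)
  then show ?case by (auto simp: matching_eq[OF step.hyps(1-5)])
qed simp

lemma Q_tableau_eq:
  assumes "\<sigma> permutes {1..n}"
  shows "Q_tableau n \<sigma> = P_tableau n (inv \<sigma>)"
proof -
  have inj: "inj \<sigma>" using assms by (rule permutes_inj)
  have "box (inv \<sigma>) n n = prod.swap ` box \<sigma> n n"
    using permutes_inverses[OF assms] by (force simp: box_def)
  \<comment> \<open>Recording yields bottom entry \<open>fst q\<close> and top entry
    \<open>fst p\<close>, which are the heights of the reflected points.\<close>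
  moreover have "record_column \<sigma> (column_of (p, q)) = column_of (prod.swap q, prod.swap p)"
    if "(p, q) \<in> set (matching (box \<sigma> n n))" for p q
  proof -
    have "p \<in> box \<sigma> n n" "q \<in> box \<sigma> n n"
      using that set_matching[OF placement_box[OF inj]] by blast+
    then show ?thesis using inj by (auto simp: box_def inv_f_f)
  qed
  ultimately show ?thesis
    unfolding Q_tableau_def P_tableau_eq[OF assms] P_tableau_eq[OF permutes_inv[OF assms]]
    by (auto simp: tableau_of_def matching_swap[OF placement_box[OF inj]])
qed

theorem theorem3p2:
  fixes n :: nat and \<sigma> :: "nat \<Rightarrow> nat"
  assumes "n \<ge> 1" and "\<sigma> permutes {1..n}"
  shows "saturated_chain (P_chain n \<sigma>) \<and> saturated_chain (Q_chain n \<sigma>) \<and>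
         standard_tableau n (P_hat n \<sigma>) \<and> standard_tableau n (Q_hat n \<sigma>) \<and>
         P_hat n \<sigma> = P_tableau n \<sigma> \<and> Q_hat n \<sigma> = Q_tableau n \<sigma>"
proof -
  note perm = assms(2) and inv = permutes_inv[OF assms(2)]
  \<comment> \<open>The upper boundary for \<open>\<sigma>\<close> is the right boundary for its
    inverse, so each claim about \<open>Q\<close> becomes one about \<open>P\<close>.\<close>
  have chain: "Q_chain n \<sigma> = P_chain n (inv \<sigma>)"
    unfolding Q_chain_def P_chain_def growth_inv[OF permutes_bij[OF perm]] ..
  then have "Q_hat n \<sigma> = P_hat n (inv \<sigma>)" by (simp add: Q_hat_def P_hat_def)
  then show ?thesis
    using saturated_P_chain[OF perm] saturated_P_chain[OF inv] standard_P[OF perm]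
      standard_P[OF inv] P_hat_eq[OF perm] P_hat_eq[OF inv] Q_tableau_eq[OF perm] chain
    by simp
qed

end
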